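(* Let $\mathcal{A}$ be a unital Banach algebra and let $a,b,c,d\in\mathcal{A}$ satisfy $acd=dbd$ and $dba=aca$. Put $\alpha=1-ac$ and $\beta=1-bd$, and let $k$ be a non-negative integer. Then $\alpha$ is left (resp. right) Drazin invertible with index $k$ if and only if $\beta$ is left (resp. right) Drazin invertible with index $k$. More precisely, put $r=\sum_{j=0}^{k-1}[1-(ac)^2]^j$ and $r'=\sum_{j=0}^{k-1}[1-(bd)^2]^j$. If $x$ is a left (resp. right) Drazin inverse of $\alpha$ with index $k$ and $p=1-x\alpha$ (resp. $p=1-\alpha x$), then $$y=(1-bacprd)(1+bd)+bacxd$$ is a left (resp. right) Drazin inverse of $\beta$. Conversely, if $y$ is a left (resp. right) Drazin inverse of $\beta$ with index $k$ and $p'=1-y\beta$ (resp. $p'=1-\beta y$), then $$x=(1-dp'r'bac)(1+ac)+dybac$$ is a left (resp. right) Drazin inverse of $\alpha$.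
   Context: An element $a\in\mathcal{A}$ is left Drazin invertible with index $j$ (a non-negative integer) if there exists $x\in\mathcal{A}$ such that $axa=xa^2$, $x^2a=x$, $xa^{j+1}=a^j$; such an $x$ is called a left Drazin inverse of $a$ (with index $j$). Dually, $a$ is right Drazin invertible with index $j$ if there exists $y\in\mathcal{A}$ such that $aya=a^2y$, $ay^2=y$, $a^{j+1}y=a^j$; such a $y$ is called a right Drazin inverse of $a$ (with index $j$). Empty sums are $0$. *)

theory Defs
  imports Complex_Main
begin

text \<open>The index j is not required to be minimal.\<close>

definition left_drazin_inverse :: "'a::monoid_mult \<Rightarrow> nat \<Rightarrow> 'a \<Rightarrow> bool" where
  "left_drazin_inverse a j x \<longleftrightarrow>
     a * x * a = x * a ^ 2 \<and> x ^ 2 * a = x \<and> x * a ^ (j + 1) = a ^ j"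

definition right_drazin_inverse :: "'a::monoid_mult \<Rightarrow> nat \<Rightarrow> 'a \<Rightarrow> bool" where
  "right_drazin_inverse a j y \<longleftrightarrow>
     a * y * a = a ^ 2 * y \<and> a * y ^ 2 = y \<and> a ^ (j + 1) * y = a ^ j"

definition left_drazin_invertible :: "'a::monoid_mult \<Rightarrow> nat \<Rightarrow> bool" where
  "left_drazin_invertible a j \<longleftrightarrow> (\<exists>x. left_drazin_inverse a j x)"

definition right_drazin_invertible :: "'a::monoid_mult \<Rightarrow> nat \<Rightarrow> bool" where
  "right_drazin_invertible a j \<longleftrightarrow> (\<exists>y. right_drazin_inverse a j y)"

end

theory Submission
  imports Defs
begin

text \<open>
  Put \<open>A = ac\<close>, \<open>B = bd\<close> and \<open>e = bac\<close>.  The hypotheses \<open>acd = dbd\<close> and \<open>dba = aca\<close> give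
  \<open>A d = d B\<close>, \<open>e A = B e\<close>, \<open>d e = A\<^sup>2\<close> and \<open>e d = B\<^sup>2\<close>.  The proof rests on these four
  identities alone.  They are invariant under exchanging \<open>(A, d)\<close> with \<open>(B, e)\<close>, so
  passing from \<open>\<beta>\<close> to \<open>\<alpha>\<close> is the same as passing from \<open>\<alpha>\<close> to \<open>\<beta>\<close>; they form the locale
  \<open>intertwined_squares\<close>.

  A left or right Drazin inverse is governed by the element \<open>p = 1 - x \<alpha>\<close> or \<open>p = 1 - \<alpha> x\<close>:
  it commutes with \<open>\<alpha>\<close>, is annihilated by \<open>\<alpha> ^ k\<close>, and is annihilated by \<open>x\<close> from the appropriate
  side; conversely these properties characterize the inverse.  The element for \<open>\<beta>\<close> turns out to be
  \<open>q = e p r d\<close>.  Indeed \<open>r\<close> is a truncated geometric series, so \<open>r A\<^sup>2 = 1 - (1 - A\<^sup>2) ^ k\<close>, and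
  \<open>(1 - A\<^sup>2) ^ k\<close> is a multiple of \<open>\<alpha> ^ k\<close>, which \<open>p\<close> kills; so \<open>r\<close> inverts \<open>A\<^sup>2 = d e\<close>
  on the part cut out by \<open>p\<close>, and \<open>q\<close> is the transport of \<open>p\<close> along \<open>d\<close> and \<open>e\<close>.  For the proposed
  inverse \<open>y\<close> of \<open>\<beta>\<close> the term \<open>(1 + B) \<beta> = 1 - B\<^sup>2 = 1 - e d\<close> then combines with
  \<open>e x d \<beta> = e (x \<alpha>) d = e d - e p d\<close> and
  \<open>q e d = e p d\<close> to give \<open>y \<beta> = 1 - q\<close>, and dually on the right.  The two transport theorems
  in the locale carry this out.
\<close>

section \<open>Drazin inverses via complementary elements\<close>

text \<open>
  The three defining equations say, in this order, that the complementary element \<open>1 - x a\<close>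
  commutes with \<open>a\<close>, is annihilated by \<open>x\<close>, and annihilates \<open>a ^ j\<close>.
\<close>

lemma left_drazin_inverse_iff:
  fixes a x :: "'a::ring_1"
  shows "left_drazin_inverse a j x \<longleftrightarrow>
    a * (1 - x * a) = (1 - x * a) * a \<and> x * (1 - x * a) = 0 \<and> (1 - x * a) * a ^ j = 0"
  unfolding left_drazin_inverse_def
  by (auto simp: algebra_simps power2_eq_square)

lemma right_drazin_inverse_iff:
  fixes a y :: "'a::ring_1"
  shows "right_drazin_inverse a j y \<longleftrightarrow>
    a * (1 - a * y) = (1 - a * y) * a \<and> (1 - a * y) * y = 0 \<and> a ^ j * (1 - a * y) = 0"
  unfolding right_drazin_inverse_def power_add power_one_right
  by (auto simp: algebra_simps power2_eq_square)

section \<open>Transport along intertwined elements\<close>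

lemma geometric_sum_times_one_minus:
  fixes u :: "'a::ring_1"
  shows "(\<Sum>j<k. u ^ j) * (1 - u) = 1 - u ^ k"
proof (induction k)
  case (Suc k)
  have "u ^ k * (1 - u) = u ^ k - u ^ Suc k"
    by (simp add: right_diff_distrib power_commutes)
  with Suc show ?case
    by (simp add: distrib_right)
qed simp

lemma commute_geometric_sum:
  fixes u p :: "'a::ring_1"
  assumes "p * u = u * p"
  shows "p * (\<Sum>j<k. u ^ j) = (\<Sum>j<k. u ^ j) * p"
  by (simp add: sum_distrib_left sum_distrib_right power_commuting_commutes[OF assms[symmetric]])

lemma one_minus_square_power:
  fixes u :: "'a::ring_1"
  shows "(1 - u\<^sup>2) ^ k = (1 - u) ^ k * (1 + u) ^ k"
proof (induction k)
  case (Suc k)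
  have factor: "1 - u\<^sup>2 = (1 - u) * (1 + u)"
    by (simp add: algebra_simps power2_eq_square)
  have "(1 - u) * (1 + u) = (1 + u) * (1 - u)"
    by (simp add: algebra_simps)
  then have comm: "(1 + u) * (1 - u) ^ k = (1 - u) ^ k * (1 + u)"
    by (rule power_commuting_commutes[symmetric])
  have "(1 - u\<^sup>2) ^ Suc k = (1 - u) * ((1 + u) * (1 - u) ^ k) * (1 + u) ^ k"
    unfolding power_Suc Suc by (simp add: factor mult.assoc)
  also have "\<dots> = (1 - u) ^ Suc k * (1 + u) ^ Suc k"
    by (simp add: comm mult.assoc)
  finally show ?case .
qed simp

locale intertwined_squares =
  fixes A B d e :: "'a::ring_1"
  assumes Ad: "A * d = d * B"
    and eA: "e * A = B * e"
    and de: "d * e = A\<^sup>2"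
    and ed: "e * d = B\<^sup>2"
begin

text \<open>The axioms are invariant under exchanging the two sides, which gives every transport
  result below in the opposite direction as well.\<close>

lemma swap: "intertwined_squares B A e d"
  by unfold_locales (simp_all add: Ad eA de ed)

lemma power_intertwines: "d * (1 - B) ^ j = (1 - A) ^ j * d"
proof (induction j)
  case (Suc j)
  have step: "d * (1 - B) = (1 - A) * d"
    by (simp add: algebra_simps Ad)
  have "d * (1 - B) ^ Suc j = (d * (1 - B)) * (1 - B) ^ j"
    by (simp add: mult.assoc)
  also have "\<dots> = (1 - A) * (d * (1 - B) ^ j)"
    by (simp add: step mult.assoc)
  finally show ?case
    by (simp add: Suc mult.assoc)
qed simp

context
  fixes p r :: 'a and k :: nat
  assumes pA: "p * A = A * p"
    and p_nil: "p * (1 - A) ^ k = 0"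
    and r: "r = (\<Sum>j<k. (1 - A\<^sup>2) ^ j)"
begin

lemma pr_commute: "p * r = r * p"
proof -
  have "p * (A * A) = (A * A) * p"
    by (metis pA mult.assoc)
  then have "p * (1 - A\<^sup>2) = (1 - A\<^sup>2) * p"
    by (simp add: algebra_simps power2_eq_square)
  then show ?thesis
    unfolding r by (rule commute_geometric_sum)
qed

lemma Ar_commute: "A * r = r * A"
  unfolding r by (rule commute_geometric_sum) (simp add: algebra_simps power2_eq_square)

text \<open>Because \<open>1 - r A\<^sup>2\<close> is a multiple of \<open>(1 - A) ^ k\<close>, which \<open>p\<close> annihilates, \<open>r\<close> acts as
  an inverse of \<open>A\<^sup>2\<close> next to \<open>p\<close>.\<close>

lemma p_r_square: "p * r * A\<^sup>2 = p"
proof -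
  have "r * A\<^sup>2 = 1 - (1 - A\<^sup>2) ^ k"
    using geometric_sum_times_one_minus[of "1 - A\<^sup>2" k] by (simp add: r)
  moreover have "p * (1 - A\<^sup>2) ^ k = 0"
    by (simp add: one_minus_square_power p_nil flip: mult.assoc)
  ultimately show ?thesis
    by (simp add: mult.assoc right_diff_distrib)
qed

text \<open>In the following facts about \<open>q = e p r d\<close>, factors of \<open>B\<close> are moved through \<open>d\<close> or
  \<open>e\<close> and reappear as factors of \<open>A\<close> next to \<open>p\<close> and \<open>r\<close>, with which they commute, and a
  product \<open>d e\<close> in the middle of a word becomes \<open>A\<^sup>2\<close>, which \<open>r\<close> cancels.  Thus \<open>q\<close> inherits
  from \<open>p\<close> that it commutes with \<open>B\<close>, annihilates \<open>(1 - B) ^ k\<close> and is idempotent.\<close>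

lemma transported_commutes: "B * (e * p * r * d) = (e * p * r * d) * B"
proof -
  have "B * (e * p * r * d) = e * (A * p) * r * d"
    by (simp add: eA flip: mult.assoc)
  also have "\<dots> = e * p * (A * r) * d"
    by (simp add: mult.assoc flip: pA)
  also have "\<dots> = e * p * r * (A * d)"
    by (simp only: Ar_commute mult.assoc)
  finally show ?thesis
    by (simp add: mult.assoc Ad)
qed

lemma transported_nil: "(e * p * r * d) * (1 - B) ^ k = 0"
proof -
  have "(e * p * r * d) * (1 - B) ^ k = e * (r * p) * ((1 - A) ^ k * d)"
    by (simp add: mult.assoc power_intertwines flip: pr_commute)
  also have "\<dots> = e * r * (p * (1 - A) ^ k) * d"
    by (simp only: mult.assoc)
  finally show ?thesis
    by (simp add: p_nil)
qed

lemma ed_transported: "(e * d) * (e * p * r * d) = e * p * d"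
proof -
  have "(e * d) * (e * p * r * d) = e * ((A\<^sup>2 * p) * r) * d"
    by (simp add: mult.assoc flip: de)
  also have "(A\<^sup>2 * p) * r = p * r * A\<^sup>2"
    by (simp add: power2_eq_square mult.assoc) (metis Ar_commute pA mult.assoc)
  finally show ?thesis
    by (simp add: p_r_square)
qed

lemma transported_ed: "(e * p * r * d) * (e * d) = e * p * d"
proof -
  have "(e * p * r * d) * (e * d) = e * (p * r * A\<^sup>2) * d"
    by (simp add: mult.assoc flip: de)
  then show ?thesis
    by (simp add: p_r_square)
qed

lemma transported_idem:
  assumes "p * p = p"
  shows "(e * p * r * d) * (e * p * r * d) = e * p * r * d"
proof -
  have "(e * p * r * d) * (e * p * r * d) = e * (p * r * A\<^sup>2) * p * r * d"
    by (simp add: mult.assoc flip: de)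
  also have "\<dots> = e * (p * p) * r * d"
    unfolding p_r_square by (simp only: mult.assoc)
  finally show ?thesis
    using assms by simp
qed

end

text \<open>The complementary element of the new inverse \<open>y\<close> is \<open>q = e p r d\<close>.  The side on which
  \<open>x\<close> annihilates \<open>p\<close> decides the side on which \<open>y\<close> annihilates \<open>q\<close>: the correction term
  contributes \<open>e x d q = e x A\<^sup>2 p r d = e (x p) A\<^sup>2 r d = 0\<close>, and the other term vanishes since \<open>q\<close>
  is idempotent and commutes with \<open>1 + B\<close>.\<close>

theorem left_drazin_inverse_transport:
  assumes x: "left_drazin_inverse (1 - A) k x"
    and p: "p = 1 - x * (1 - A)"
    and r: "r = (\<Sum>j<k. (1 - A\<^sup>2) ^ j)"
  shows "left_drazin_inverse (1 - B) k ((1 - e * p * r * d) * (1 + B) + e * x * d)"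
proof -
  define q where "q = e * p * r * d"
  define y where "y = (1 - q) * (1 + B) + e * x * d"
  from x have comm: "(1 - A) * p = p * (1 - A)" and xp: "x * p = 0" and nil: "p * (1 - A) ^ k = 0"
    by (simp_all add: left_drazin_inverse_iff p)
  have pA: "p * A = A * p"
    using comm by (simp add: algebra_simps)
  \<comment> \<open>\<open>p\<close> is idempotent: \<open>(1 - p) p = x (1 - A) p = (x p) (1 - A)\<close>, and \<open>x p = 0\<close>.\<close>
  have "(1 - p) * p = x * (p * (1 - A))"
    by (simp add: p mult.assoc comm[symmetric, unfolded p])
  then have idem: "p * p = p"
    by (simp add: xp algebra_simps flip: mult.assoc)
  note qB = transported_commutes[OF pA nil r, folded q_def]
    and q_nil = transported_nil[OF pA nil r, folded q_def]
    and q_ed = transported_ed[OF pA nil r, folded q_def]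
    and q_idem = transported_idem[OF pA nil r idem, folded q_def]
  have x\<alpha>: "x * (1 - A) = 1 - p"
    by (simp add: p)
  have "y * (1 - B) = (1 - q) * (1 - e * d) + e * x * (d * (1 - B))"
    by (simp add: y_def ed algebra_simps power2_eq_square)
  also have "d * (1 - B) = (1 - A) * d"
    by (simp add: algebra_simps Ad)
  also have "e * x * ((1 - A) * d) = e * (x * (1 - A)) * d"
    by (simp only: mult.assoc)
  also have "\<dots> = e * d - e * p * d"
    unfolding x\<alpha> by (simp add: algebra_simps)
  finally have compl: "1 - y * (1 - B) = q"
    by (simp add: algebra_simps q_ed)
  have "y * q = (1 - q) * (1 + B) * q + e * (x * (A\<^sup>2 * p)) * r * d"
    by (simp add: y_def q_def algebra_simps flip: de)
  also have "A\<^sup>2 * p = p * A\<^sup>2"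
    by (metis pA power2_eq_square mult.assoc)
  also have "(1 - q) * (1 + B) * q = (q - q * q) * (1 + B)"
    using qB by (simp add: algebra_simps)
  finally have "y * q = 0"
    by (simp add: q_idem xp flip: mult.assoc)
  moreover have "(1 - B) * q = q * (1 - B)"
    using qB by (simp add: algebra_simps)
  ultimately show ?thesis
    unfolding left_drazin_inverse_iff y_def[symmetric] q_def[symmetric]
    using q_nil by (simp add: compl)
qed

text \<open>The mirror image: multiplication in the opposite ring exchanges \<open>d\<close> with \<open>e\<close> and leaves the
  axioms as they are, while it reverses \<open>e p r d\<close> into \<open>e r p d\<close>, which is the same element
  because \<open>p\<close> and \<open>r\<close> commute.  The factors \<open>1 - q\<close> and \<open>1 + B\<close> of the new inverse commute as well,
  so its formula is its own mirror image.\<close>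

theorem right_drazin_inverse_transport:
  assumes x: "right_drazin_inverse (1 - A) k x"
    and p: "p = 1 - (1 - A) * x"
    and r: "r = (\<Sum>j<k. (1 - A\<^sup>2) ^ j)"
  shows "right_drazin_inverse (1 - B) k ((1 - e * p * r * d) * (1 + B) + e * x * d)"
proof -
  define q where "q = e * p * r * d"
  define y where "y = (1 - q) * (1 + B) + e * x * d"
  from x have comm: "(1 - A) * p = p * (1 - A)" and px: "p * x = 0" and nil': "(1 - A) ^ k * p = 0"
    by (simp_all add: right_drazin_inverse_iff p)
  have nil: "p * (1 - A) ^ k = 0"
    using nil' power_commuting_commutes[OF comm] by simp
  have pA: "p * A = A * p"
    using comm by (simp add: algebra_simps)
  have "p * (1 - p) = (p * (1 - A)) * x"
    by (simp add: p mult.assoc)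
  also have "\<dots> = (1 - A) * (p * x)"
    by (simp only: mult.assoc flip: comm)
  finally have idem: "p * p = p"
    by (simp add: px right_diff_distrib)
  note qB = transported_commutes[OF pA nil r, folded q_def]
    and q_nil = transported_nil[OF pA nil r, folded q_def]
    and ed_q = ed_transported[OF pA nil r, folded q_def]
    and q_idem = transported_idem[OF pA nil r idem, folded q_def]
  have \<alpha>x: "(1 - A) * x = 1 - p"
    by (simp add: p)
  have comm_q: "(1 - B) * q = q * (1 - B)"
    using qB by (simp add: algebra_simps)
  have "(1 - B) * ((1 - q) * (1 + B)) = (1 - e * d) * (1 - q)"
    using qB by (simp add: ed algebra_simps power2_eq_square)
  moreover have "(1 - B) * (e * x * d) = e * ((1 - A) * x) * d"
    by (simp add: left_diff_distrib right_diff_distrib eA flip: mult.assoc)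
  ultimately have "(1 - B) * y = (1 - e * d) * (1 - q) + e * (1 - p) * d"
    by (simp add: y_def distrib_left \<alpha>x)
  then have compl: "1 - (1 - B) * y = q"
    by (simp add: algebra_simps ed_q[unfolded mult.assoc])
  have "q * (e * x * d) = e * (p * r * A\<^sup>2) * x * d"
    by (simp add: q_def mult.assoc flip: de)
  also have "\<dots> = e * (p * x) * d"
    unfolding p_r_square[OF pA nil r] by (simp only: mult.assoc)
  finally have "q * y = (q - q * q) * (1 + B)"
    by (simp add: y_def px algebra_simps)
  then have "q * y = 0"
    by (simp add: q_idem)
  moreover have "(1 - B) ^ k * q = 0"
    using q_nil power_commuting_commutes[OF comm_q] by simp
  ultimately show ?thesis
    unfolding right_drazin_inverse_iff y_def[symmetric] q_def[symmetric]
    using comm_q by (simp add: compl)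
qed

end

section \<open>The four elements of the algebra\<close>

lemma intertwined_squares_of_products:
  fixes a b c d :: "'a::ring_1"
  assumes acd: "a * c * d = d * b * d"
    and dba: "d * b * a = a * c * a"
  shows "intertwined_squares (a * c) (b * d) d (b * a * c)"
proof
  show "a * c * d = d * (b * d)"
    using acd by (simp only: mult.assoc)
  have dba': "d * (b * (a * z)) = a * (c * (a * z))" for z
    using arg_cong[OF dba, of "\<lambda>t. t * z"] by (simp add: mult.assoc)
  show "b * a * c * (a * c) = b * d * (b * a * c)" "d * (b * a * c) = (a * c)\<^sup>2"
    by (simp_all add: mult.assoc power2_eq_square dba')
  show "b * a * c * d = (b * d)\<^sup>2"
    using acd by (simp add: mult.assoc power2_eq_square)
qed

theorem theorem3p5:
  fixes a b c d \<alpha> \<beta> r r' :: "'a::{real_normed_algebra, real_algebra_1, banach}"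
    and k :: nat
  assumes "a * c * d = d * b * d"
    and "d * b * a = a * c * a"
    and "\<alpha> = 1 - a * c"
    and "\<beta> = 1 - b * d"
    and "r = (\<Sum>j<k. (1 - (a * c) ^ 2) ^ j)"
    and "r' = (\<Sum>j<k. (1 - (b * d) ^ 2) ^ j)"
  shows
    "(left_drazin_invertible \<alpha> k \<longleftrightarrow> left_drazin_invertible \<beta> k) \<and>
     (right_drazin_invertible \<alpha> k \<longleftrightarrow> right_drazin_invertible \<beta> k) \<and>
     (\<forall>x p. left_drazin_inverse \<alpha> k x \<and> p = 1 - x * \<alpha> \<longrightarrow>
        left_drazin_inverse \<beta> k
          ((1 - b * a * c * p * r * d) * (1 + b * d) + b * a * c * x * d)) \<and>
     (\<forall>x p. right_drazin_inverse \<alpha> k x \<and> p = 1 - \<alpha> * x \<longrightarrow>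
        right_drazin_inverse \<beta> k
          ((1 - b * a * c * p * r * d) * (1 + b * d) + b * a * c * x * d)) \<and>
     (\<forall>y p'. left_drazin_inverse \<beta> k y \<and> p' = 1 - y * \<beta> \<longrightarrow>
        left_drazin_inverse \<alpha> k
          ((1 - d * p' * r' * b * a * c) * (1 + a * c) + d * y * b * a * c)) \<and>
     (\<forall>y p'. right_drazin_inverse \<beta> k y \<and> p' = 1 - \<beta> * y \<longrightarrow>
        right_drazin_inverse \<alpha> k
          ((1 - d * p' * r' * b * a * c) * (1 + a * c) + d * y * b * a * c))"
proof -
  interpret fwd: intertwined_squares "a * c" "b * d" d "b * a * c"
    by (rule intertwined_squares_of_products[OF assms(1,2)])
  interpret bwd: intertwined_squares "b * d" "a * c" "b * a * c" d
    by (rule fwd.swap)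
  note fwd_left = fwd.left_drazin_inverse_transport[OF _ refl assms(5), folded assms(3,4)]
    and fwd_right = fwd.right_drazin_inverse_transport[OF _ refl assms(5), folded assms(3,4)]
    and bwd_left = bwd.left_drazin_inverse_transport[OF _ refl assms(6), folded assms(3,4)]
    and bwd_right = bwd.right_drazin_inverse_transport[OF _ refl assms(6), folded assms(3,4)]
  have "left_drazin_invertible \<alpha> k \<longleftrightarrow> left_drazin_invertible \<beta> k"
    unfolding left_drazin_invertible_def using fwd_left bwd_left by blast
  moreover have "right_drazin_invertible \<alpha> k \<longleftrightarrow> right_drazin_invertible \<beta> k"
    unfolding right_drazin_invertible_def using fwd_right bwd_right by blast
  ultimately show ?thesis
    using fwd_left fwd_right bwd_left bwd_right by (simp add: mult.assoc)
qed

end
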